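(* Let $G\simeq[k,l,m]$ be a crystallographic string Coxeter group of rank $4$ (so $k,l,m\in\{2,3,4,6,\infty\}$). Suppose the subgroup $[k,l]=\langle r_0,r_1,r_2\rangle$ or the subgroup $[l,m]=\langle r_1,r_2,r_3\rangle$ is Euclidean (i.e. an affine Coxeter group), and that $l=4$ or $6$. Then for every prime $p\ge3$ the reduction $G^p$ of $G$ modulo $p$ is a (string) C-group.
   Context: Setting. $G=\langle r_0,\dots,r_{n-1}\rangle=[p_1,\dots,p_{n-1}]$ denotes a crystallographic Coxeter group with string Coxeter diagram (nodes $0,\dots,n-1$; the branch joining nodes $i-1$ and $i$ is marked $p_i$; $p_i=2$ means no branch), so each $p_i\in\{2,3,4,6,\infty\}$, in its standard representation as a reflection group on real $n$-space $V$. A basic system is a basis $b_0,\dots,b_{n-1}$ of $V$ of suitably rescaled simple roots: $b_i\cdot b_i>0$, $b_{i-1}\cdot b_i=-\cos(\pi/p_i)\sqrt{(b_{i-1}\cdot b_{i-1})(b_i\cdot b_i)}$ (with $\cos(\pi/\infty)=1$), $b_i\cdot b_j=0$ for $|i-j|\ge2$, $r_i(x)=x-2\frac{x\cdot b_i}{b_i\cdot b_i}b_i$, and all numbers $2\frac{b_i\cdot b_j}{b_i\cdot b_i}$ are integers. Reduction. For an odd prime $p$, the integer matrices of the $r_i$ in the basis $(b_i)$ are reduced modulo $p$; $G^p$ is the subgroup of $GL_n(\mathbb Z_p)$ (where $\mathbb Z_p=\mathbb Z/p\mathbb Z$) generated by these reductions, again denoted $r_0,\dots,r_{n-1}$. In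 some cases with $p=3$ and some $p_i=6$, $G^p$ may depend on the basic system; the statement refers to any choice of basic system. $G^p$ is a (string) C-group if $\langle r_i\mid i\in I\rangle\cap\langle r_i\mid i\in J\rangle=\langle r_i\mid i\in I\cap J\rangle$ in $G^p$ for all $I,J\subseteq\{0,\dots,n-1\}$. *)

theory Defs
  imports
    "HOL-Analysis.Linear_Algebra"
    "HOL-Library.Extended_Nat"
    "HOL-Algebra.Generated_Groups"
    "Jordan_Normal_Form.Matrix"
    "Berlekamp_Zassenhaus.Finite_Field"
begin

text \<open>
  The string diagram \<open>[p\<^sub>1, \<dots>, p\<^sub>n\<^sub>-\<^sub>1]\<close> is the list \<open>ps\<close> of its marks, so that
  \<open>ps ! i\<close> is the mark \<open>p\<^sub>i\<^sub>+\<^sub>1\<close> between the nodes \<open>i\<close> and \<open>Suc i\<close>, and the rank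
  is \<open>n = Suc (length ps)\<close>.
\<close>

fun cos_mark :: "enat \<Rightarrow> real" where
  "cos_mark (enat q) = cos (pi / real q)"
| "cos_mark \<infinity> = 1"

definition coxeter_gram :: "enat list \<Rightarrow> nat \<Rightarrow> nat \<Rightarrow> real" where
  "coxeter_gram ps i j =
     (if i = j then 1
      else if j = Suc i then - cos_mark (ps ! i)
      else if i = Suc j then - cos_mark (ps ! j)
      else 0)"

definition coxeter_form :: "enat list \<Rightarrow> (nat \<Rightarrow> real) \<Rightarrow> real" where
  "coxeter_form ps x = (\<Sum>i\<le>length ps. \<Sum>j\<le>length ps. coxeter_gram ps i j * x i * x j)"

text \<open>
  An affine Coxeter group is an irreducible one whose canonical form is positive
  semidefinite but not positive definite. A mark 2 disconnects the diagram.
\<close>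

definition euclidean_coxeter :: "enat list \<Rightarrow> bool" where
  "euclidean_coxeter ps \<longleftrightarrow>
     2 \<notin> set ps \<and>
     (\<forall>x. 0 \<le> coxeter_form ps x) \<and>
     (\<exists>x. (\<exists>i\<le>length ps. x i \<noteq> 0) \<and> coxeter_form ps x = 0)"

text \<open>
  The ambient form \<open>B\<close> may be degenerate or indefinite, so it is an arbitrary
  symmetric bilinear form and not the inner product of a Euclidean space.
\<close>

definition basic_system ::
    "enat list \<Rightarrow> ('v::real_vector \<Rightarrow> 'v \<Rightarrow> real) \<Rightarrow> (nat \<Rightarrow> 'v) \<Rightarrow> bool" where
  "basic_system ps B b \<longleftrightarrow>
     bilinear B \<and> (\<forall>x y. B x y = B y x) \<and>
     inj_on b {..length ps} \<and>
     independent (b ` {..length ps}) \<and>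
     span (b ` {..length ps}) = UNIV \<and>
     (\<forall>i\<le>length ps. 0 < B (b i) (b i)) \<and>
     (\<forall>i<length ps. B (b i) (b (Suc i)) =
        - cos_mark (ps ! i) * sqrt (B (b i) (b i) * B (b (Suc i)) (b (Suc i)))) \<and>
     (\<forall>i j. i + 2 \<le> j \<and> j \<le> length ps \<longrightarrow> B (b i) (b j) = 0) \<and>
     (\<forall>i\<le>length ps. \<forall>j\<le>length ps. 2 * B (b i) (b j) / B (b i) (b i) \<in> \<int>)"

definition root_reflection :: "('v::real_vector \<Rightarrow> 'v \<Rightarrow> real) \<Rightarrow> 'v \<Rightarrow> 'v \<Rightarrow> 'v" where
  "root_reflection B a x = x - (2 * B x a / B a a) *\<^sub>R a"

text \<open>
  Column \<open>j\<close> of the matrix of \<open>r\<^sub>k\<close> holds the coordinates of \<open>r\<^sub>k (b\<^sub>j)\<close>. For a basic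
  system these are integers (lemma \<open>of_int_reflection_matrix\<close>), so the floor only
  changes their type.
\<close>

definition reflection_matrix ::
    "('v::real_vector \<Rightarrow> 'v \<Rightarrow> real) \<Rightarrow> (nat \<Rightarrow> 'v) \<Rightarrow> nat \<Rightarrow> nat \<Rightarrow> int mat" where
  "reflection_matrix B b n k =
     mat n n (\<lambda>(i, j). \<lfloor>representation (b ` {..<n}) (root_reflection B (b k) (b j)) (b i)\<rfloor>)"

lemma of_int_reflection_matrix:
  assumes bs: "basic_system ps B b" and n: "n = Suc (length ps)"
    and less: "i < n" "j < n" "k < n"
  shows "real_of_int (reflection_matrix B b n k $$ (i, j)) =
    representation (b ` {..<n}) (root_reflection B (b k) (b j)) (b i)"
proof -
  let ?S = "b ` {..<n}"
  have S: "{..<n} = {..length ps}"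
    using n by (simp add: lessThan_Suc_atMost)
  have ind: "independent ?S" and inj: "inj_on b {..<n}"
    and sym: "B (b j) (b k) = B (b k) (b j)"
    using bs unfolding basic_system_def S by blast+
  have le: "j \<le> length ps" "k \<le> length ps"
    using less n by auto
  have int: "2 * B (b k) (b j) / B (b k) (b k) \<in> \<int>"
    using bs le unfolding basic_system_def by blast
  have mem: "b j \<in> span ?S" "b k \<in> span ?S"
    using less by (auto intro: span_base)
  have rep: "representation ?S (b m) (b i) = (if m = i then 1 else 0)" if "m < n" for m
    using that less inj by (auto simp: real_vector.representation_basis[OF ind] dest: inj_onD)
  have "representation ?S (root_reflection B (b k) (b j)) (b i) =
      representation ?S (b j) (b i)
        - 2 * B (b k) (b j) / B (b k) (b k) * representation ?S (b k) (b i)"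
    unfolding root_reflection_def sym
    using mem by (simp add: real_vector.representation_diff[OF ind]
        real_vector.representation_scale[OF ind] span_scale)
  also have "\<dots> \<in> \<int>"
    using int less by (auto simp: rep)
  finally have "representation ?S (root_reflection B (b k) (b j)) (b i) \<in> \<int>" .
  then show ?thesis
    using less by (simp add: reflection_matrix_def)
qed

definition general_linear_group :: "nat \<Rightarrow> 'a::comm_ring_1 mat monoid" where
  "general_linear_group n = units_of (ring_mat TYPE('a) n ())"

definition reduced_reflection ::
    "('v::real_vector \<Rightarrow> 'v \<Rightarrow> real) \<Rightarrow> (nat \<Rightarrow> 'v) \<Rightarrow> nat \<Rightarrow> nat
      \<Rightarrow> 'p::prime_card mod_ring mat" where
  "reduced_reflection B b n k = map_mat of_int (reflection_matrix B b n k)"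

text \<open>The group \<open>G\<^sup>p\<close>, where \<open>p = CARD('p)\<close>.\<close>

definition reduced_group ::
    "('v::real_vector \<Rightarrow> 'v \<Rightarrow> real) \<Rightarrow> (nat \<Rightarrow> 'v) \<Rightarrow> nat
      \<Rightarrow> 'p::prime_card mod_ring mat monoid" where
  "reduced_group B b n =
     (general_linear_group n)
       \<lparr>carrier := generate (general_linear_group n) (reduced_reflection B b n ` {..<n})\<rparr>"

definition C_group :: "('g, 'x) monoid_scheme \<Rightarrow> (nat \<Rightarrow> 'g) \<Rightarrow> nat \<Rightarrow> bool" where
  "C_group G r n \<longleftrightarrow>
     (\<forall>I\<subseteq>{..<n}. \<forall>J\<subseteq>{..<n}.
        generate G (r ` I) \<inter> generate G (r ` J) = generate G (r ` (I \<inter> J)))"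

end

theory Submission
  imports Defs
begin

text \<open>
  Let \<open>T\<close> be the Euclidean parabolic subgroup, say \<open>T = \<langle>r\<^sub>0, r\<^sub>1, r\<^sub>2\<rangle>\<close>; the other case follows by
  reversing the diagram. As a Euclidean diagram satisfies \<open>cos\<^sup>2(\<pi>/k) + cos\<^sup>2(\<pi>/l) = 1\<close>, it is
  \<open>[4, 4]\<close> if \<open>l = 4\<close> and \<open>[3, 6]\<close> if \<open>l = 6\<close>. In both cases \<open>\<langle>r\<^sub>1, r\<^sub>2\<rangle>\<close> is the point
  group of \<open>T\<close>; this is what the condition on \<open>l\<close> provides.

  Every generator \<open>r\<^sub>i\<close> changes only the coordinate \<open>x\<^sub>i\<close>. Hence an element of \<open>\<langle>r\<^sub>i | i \<in> I\<rangle>\<close> leaves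
  all coordinates outside \<open>I\<close> alone, and nodes of \<open>I\<close> that are joined to no other node of \<open>I\<close> can be
  split off. This reduces the intersection property in rank 4 to the three inclusions
  \<open>\<langle>r\<^sub>0, r\<^sub>1\<rangle> \<inter> \<langle>r\<^sub>1, r\<^sub>2\<rangle> \<subseteq> \<langle>r\<^sub>1\<rangle>\<close>, \<open>\<langle>r\<^sub>1, r\<^sub>2\<rangle> \<inter> \<langle>r\<^sub>2, r\<^sub>3\<rangle> \<subseteq> \<langle>r\<^sub>2\<rangle>\<close> and
  \<open>\<langle>r\<^sub>0, r\<^sub>1, r\<^sub>2\<rangle> \<inter> \<langle>r\<^sub>1, r\<^sub>2, r\<^sub>3\<rangle> \<subseteq> \<langle>r\<^sub>1, r\<^sub>2\<rangle>\<close> (lemma \<open>intersection_property_rank_4\<close>).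

  The first two concern small dihedral groups: a power of the rotation that leaves a suitable
  coordinate alone is trivial, which is seen on the powers one by one. For the third, every element
  of \<open>T\<close> is a product of a translation and an element of \<open>\<langle>r\<^sub>1, r\<^sub>2\<rangle>\<close>. If the product lies in
  \<open>\<langle>r\<^sub>1, r\<^sub>2, r\<^sub>3\<rangle>\<close>, then the translation leaves the coordinate \<open>x\<^sub>0\<close> alone. But on the span of
  \<open>b\<^sub>0, b\<^sub>1, b\<^sub>2\<close> a translation has the form \<open>x \<mapsto> x + f(x) c\<close>, where \<open>c\<close> spans the radical there, and
  the coordinate \<open>c\<^sub>0\<close> is nonzero; so \<open>f\<close> vanishes on \<open>b\<^sub>1, b\<^sub>2, c\<close>, and the translation is trivial
  (lemmas \<open>Int_words_012_123_44\<close> and \<open>Int_words_012_123_36\<close>). The translations are given by explicit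
  formulas that remain meaningful in characteristic 3, where one Cartan integer of a mark 6
  vanishes.
\<close>

section \<open>Words in a family of maps\<close>

text \<open>
  For a family of involutions the words form the group that it generates. Words avoid inverses, so
  every closure property is an induction that adds one generator on the left.
\<close>

inductive_set words :: "('i \<Rightarrow> 'x \<Rightarrow> 'x) \<Rightarrow> 'i set \<Rightarrow> ('x \<Rightarrow> 'x) set" for r I where
  empty: "id \<in> words r I"
| step: "i \<in> I \<Longrightarrow> w \<in> words r I \<Longrightarrow> r i \<circ> w \<in> words r I"

lemma words_generator: "i \<in> I \<Longrightarrow> r i \<in> words r I"
  using words.step[OF _ words.empty, of i I r] by simp

lemma words_comp: "v \<in> words r I \<Longrightarrow> w \<in> words r I \<Longrightarrow> v \<circ> w \<in> words r I"
  by (induction rule: words.induct) (auto simp: comp_assoc intro: words.step)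

lemma words_mono: "w \<in> words r I \<Longrightarrow> I \<subseteq> J \<Longrightarrow> w \<in> words r J"
  by (induction rule: words.induct) (auto intro: words.intros)

lemma words_empty_set [simp]: "words r {} = {id}"
  by (auto intro: words.empty elim: words.cases)

lemma words_cong:
  fixes r r' :: "'i \<Rightarrow> 'x \<Rightarrow> 'x"
  assumes "\<And>i. i \<in> I \<Longrightarrow> r i = r' i"
  shows "words r I = words r' I"
proof -
  have "words f I \<subseteq> words g I" if "\<And>i. i \<in> I \<Longrightarrow> f i = g i" for f g :: "'i \<Rightarrow> 'x \<Rightarrow> 'x"
  proof
    fix w assume "w \<in> words f I"
    then show "w \<in> words g I"
    proof (induction rule: words.induct)
      case (step i w)
      then show ?case using that by (metis words.step)
    qed (rule words.empty)
  qed
  with assms show ?thesis by (metis subset_antisym)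
qed

lemma words_surj:
  assumes "w \<in> words r I" and "\<And>i. i \<in> I \<Longrightarrow> r i \<circ> r i = id"
  shows "surj w"
  using assms
proof (induction rule: words.induct)
  case (step i w)
  then have "surj (r i)"
    by (metis comp_apply id_apply surjI)
  with step show ?case
    by (metis comp_surj)
qed simp

lemma funpow_numeral: "(f ^^ numeral n) x = f ((f ^^ pred_numeral n) x)"
  by (simp add: numeral_eq_Suc)

text \<open>
  A dihedral group consists of the powers of a rotation and their products with one reflection. The
  reflection \<open>r j\<close> is placed on the left, so that output coordinates fixed by \<open>r j\<close> only see the
  rotation.
\<close>

lemma words_dihedral:
  assumes w: "w \<in> words r {i, j}"
    and inv: "r i \<circ> r i = id" "r j \<circ> r j = id"
    and ord: "(r i \<circ> r j) ^^ n = id" and "0 < n"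
  obtains k where "k < n" and "w = (r i \<circ> r j) ^^ k \<or> w = r j \<circ> (r i \<circ> r j) ^^ k"
proof -
  let ?\<rho> = "r i \<circ> r j"
  have red: "\<exists>k'<n. ?\<rho> ^^ k = ?\<rho> ^^ k'" for k
  proof (intro exI conjI)
    show "k mod n < n" using \<open>0 < n\<close> by simp
    have "?\<rho> ^^ k = ?\<rho> ^^ (k mod n + k div n * n)"
      by simp
    also have "\<dots> = ?\<rho> ^^ (k mod n) \<circ> (?\<rho> ^^ n) ^^ (k div n)"
      by (simp only: funpow_add funpow_mult mult.commute)
    finally show "?\<rho> ^^ k = ?\<rho> ^^ (k mod n)"
      using ord by (simp add: id_funpow)
  qed
  have cancel: "r i (r i x) = x" "r j (r j x) = x" for x
    using inv by (metis comp_apply id_apply)+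
  have "\<exists>k. w = ?\<rho> ^^ k \<or> w = r j \<circ> ?\<rho> ^^ k"
    using w
  proof (induction rule: words.induct)
    case empty
    have "id = ?\<rho> ^^ 0" by simp
    then show ?case by blast
  next
    case (step a w)
    then obtain k where k: "w = ?\<rho> ^^ k \<or> w = r j \<circ> ?\<rho> ^^ k" and a: "a = i \<or> a = j"
      by blast
    from a show ?case
    proof
      assume "a = j"
      have "r j \<circ> (r j \<circ> ?\<rho> ^^ k) = ?\<rho> ^^ k"
        by (simp add: fun_eq_iff cancel)
      with k show ?thesis
        unfolding \<open>a = j\<close> by metis
    next
      assume "a = i"
      from k show ?thesis
      proof
        assume "w = r j \<circ> ?\<rho> ^^ k"
        then have "r a \<circ> w = ?\<rho> ^^ Suc k"
          by (simp add: \<open>a = i\<close> comp_assoc)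
        then show ?thesis by blast
      next
        assume w: "w = ?\<rho> ^^ k"
        \<comment> \<open>Raising the exponent by \<open>n\<close> leaves a factor \<open>r i\<close> to cancel even if \<open>k = 0\<close>.\<close>
        have "?\<rho> ^^ k = ?\<rho> ^^ (Suc (k + (n - 1)))"
          using \<open>0 < n\<close> ord by (simp add: funpow_add del: funpow.simps)
        then have "r a \<circ> w = r j \<circ> ?\<rho> ^^ (k + (n - 1))"
          unfolding w by (simp add: \<open>a = i\<close> fun_eq_iff cancel)
        then show ?thesis by blast
      qed
    qed
  qed
  with red that show thesis
    by metis
qed

lemma words_insert_commuting:
  assumes w: "w \<in> words r (insert j I)"
    and com: "\<And>i. i \<in> I \<Longrightarrow> r i \<circ> r j = r j \<circ> r i" and inv: "r j \<circ> r j = id"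
  obtains "w \<in> words r I" | h where "h \<in> words r I" "w = h \<circ> r j"
proof -
  have comw: "r j \<circ> h = h \<circ> r j" if "h \<in> words r I" for h
    using that
  proof (induction rule: words.induct)
    case (step i w)
    then show ?case
      using com[OF step.hyps(1)] by (metis comp_assoc)
  qed simp
  have "w \<in> words r I \<or> (\<exists>h\<in>words r I. w = h \<circ> r j)"
    using w
  proof (induction rule: words.induct)
    case empty
    then show ?case by (blast intro: words.empty)
  next
    case (step i w)
    consider "i \<in> I" | "i = j" using step.hyps by blast
    then show ?case
    proof cases
      case 1
      with step.IH show ?thesis
        by (metis comp_assoc words.step)
    next
      case 2
      from step.IH show ?thesis
      proof
        assume "w \<in> words r I"
        then show ?thesis using 2 comw by blast
      next
        assume "\<exists>h\<in>words r I. w = h \<circ> r j"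
        then obtain h where "h \<in> words r I" "w = h \<circ> r j" by blast
        moreover have "r j \<circ> (h \<circ> r j) = h"
          by (metis calculation(1) comp_assoc comp_id comw inv)
        ultimately show ?thesis using 2 by simp
      qed
    qed
  qed
  with that show thesis by blast
qed

text \<open>
  Renaming the indices by \<open>\<pi>\<close> and conjugating by an involution \<open>\<rho>\<close> carries words to words. It is
  used to reverse a string diagram.
\<close>

lemma words_conjugate:
  assumes "w \<in> words r I" and inv: "\<And>x. \<rho> (\<rho> x) = x"
    and conj: "\<And>i. i \<in> I \<Longrightarrow> r' (\<pi> i) = \<rho> \<circ> r i \<circ> \<rho>"
  shows "\<rho> \<circ> w \<circ> \<rho> \<in> words r' (\<pi> ` I)"
  using assms(1)
proof (induction rule: words.induct)
  case empty
  have "\<rho> \<circ> id \<circ> \<rho> = id" by (simp add: fun_eq_iff inv)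
  then show ?case by (metis words.empty)
next
  case (step i w)
  have "\<rho> \<circ> (r i \<circ> w) \<circ> \<rho> = r' (\<pi> i) \<circ> (\<rho> \<circ> w \<circ> \<rho>)"
    using conj[OF step.hyps(1)] by (simp add: fun_eq_iff inv)
  with step show ?case
    by (metis imageI words.step)
qed

section \<open>The intersection property\<close>

definition intersection_property :: "('i \<Rightarrow> 'x \<Rightarrow> 'x) \<Rightarrow> 'i set \<Rightarrow> bool" where
  "intersection_property r N \<longleftrightarrow>
     (\<forall>I\<subseteq>N. \<forall>J\<subseteq>N. words r I \<inter> words r J \<subseteq> words r (I \<inter> J))"

lemma intersection_property_cong:
  assumes "\<And>i. i \<in> N \<Longrightarrow> r i = r' i"
  shows "intersection_property r N \<longleftrightarrow> intersection_property r' N"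
proof -
  have "words r I = words r' I" if "I \<subseteq> N" for I
    using that assms by (intro words_cong) auto
  then show ?thesis
    unfolding intersection_property_def by (metis le_infI1)
qed

lemma intersection_property_conjugate:
  assumes ip: "intersection_property r' (\<pi> ` N)" and inj: "inj_on \<pi> N"
    and inv: "\<And>x. \<rho> (\<rho> x) = x"
    and conj: "\<And>i. i \<in> N \<Longrightarrow> r' (\<pi> i) = \<rho> \<circ> r i \<circ> \<rho>"
  shows "intersection_property r N"
  unfolding intersection_property_def
proof (intro allI impI subsetI)
  fix I J w assume I: "I \<subseteq> N" and J: "J \<subseteq> N" and w: "w \<in> words r I \<inter> words r J"
  have unconj: "r i = \<rho> \<circ> r' (\<pi> i) \<circ> \<rho>" if "i \<in> N" for i
    using conj[OF that] by (simp add: fun_eq_iff inv)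
  have "\<rho> \<circ> w \<circ> \<rho> \<in> words r' (\<pi> ` I) \<inter> words r' (\<pi> ` J)"
    using w I J by (auto intro!: words_conjugate inv conj)
  also have "\<dots> \<subseteq> words r' (\<pi> ` I \<inter> \<pi> ` J)"
    using ip I J unfolding intersection_property_def by (meson image_mono)
  also have "\<pi> ` I \<inter> \<pi> ` J = \<pi> ` (I \<inter> J)"
    using inj_on_image_Int[OF inj I J] by simp
  finally have conjugated: "\<rho> \<circ> w \<circ> \<rho> \<in> words r' (\<pi> ` (I \<inter> J))" .
  have "\<rho> \<circ> (\<rho> \<circ> w \<circ> \<rho>) \<circ> \<rho> \<in> words r (the_inv_into N \<pi> ` \<pi> ` (I \<inter> J))"
  proof (rule words_conjugate[OF conjugated inv])
    fix j assume "j \<in> \<pi> ` (I \<inter> J)"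
    then show "r (the_inv_into N \<pi> j) = \<rho> \<circ> r' j \<circ> \<rho>"
      using I unconj by (auto simp: the_inv_into_f_f[OF inj])
  qed
  moreover have "the_inv_into N \<pi> ` \<pi> ` (I \<inter> J) = I \<inter> J"
    using I by (force simp: image_image the_inv_into_f_f[OF inj])
  moreover have "\<rho> \<circ> (\<rho> \<circ> w \<circ> \<rho>) \<circ> \<rho> = w"
    by (simp add: fun_eq_iff inv)
  ultimately show "w \<in> words r (I \<inter> J)"
    by simp
qed

section \<open>String reflections of rank 4\<close>

lemma less_4_cases: "i < 4 \<Longrightarrow> i = 0 \<or> i = 1 \<or> i = 2 \<or> i = (3::nat)"
  by linarith

definition reverse_coords :: "(nat \<Rightarrow> 'a) \<Rightarrow> nat \<Rightarrow> 'a" where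
  "reverse_coords x i = (if i < 4 then x (3 - i) else x i)"

text \<open>
  The reductions of the Cartan integers of \<open>[4, 4]\<close> and of \<open>[3, 6]\<close>. In characteristic 3 the
  condition \<open>s t = 3\<close> would allow \<open>s = t = 0\<close>; but \<open>s\<close> and \<open>t\<close> come from integers that are
  \<open>1\<close> and \<open>3\<close> up to sign and order, so one of them survives the reduction.
\<close>

definition affine_entries :: "'a::field \<Rightarrow> 'a \<Rightarrow> 'a \<Rightarrow> 'a \<Rightarrow> bool" where
  "affine_entries p q s t \<longleftrightarrow>
     p * q = 2 \<and> s * t = 2 \<or> p = 1 \<and> q = 1 \<and> s * t = 3 \<and> (s \<noteq> 0 \<or> t \<noteq> 0)"

text \<open>
  The numbers \<open>p, q, s, t, u, v\<close> are the negatives of the off-diagonal Cartan integers, read along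
  the string: \<open>p q\<close>, \<open>s t\<close> and \<open>u v\<close> belong to the three branches. The maps act on functions on all
  of \<open>nat\<close>; only the coordinates below 4 matter.
\<close>

locale string_reflections =
  fixes r :: "nat \<Rightarrow> (nat \<Rightarrow> 'a::field) \<Rightarrow> nat \<Rightarrow> 'a" and p q s t u v :: 'a
  assumes r0: "r 0 x = x(0 := p * x 1 - x 0)"
    and r1: "r 1 x = x(1 := q * x 0 + s * x 2 - x 1)"
    and r2: "r 2 x = x(2 := t * x 1 + u * x 3 - x 2)"
    and r3: "r 3 x = x(3 := v * x 2 - x 3)"
    and two: "(2::'a) \<noteq> 0"
begin

lemmas r_apply = r0 r1 r2 r3

lemma r_involution: "i < 4 \<Longrightarrow> r i \<circ> r i = id"
  by (auto dest!: less_4_cases simp: r_apply[simplified] fun_eq_iff)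

lemma r_commute: "i < 4 \<Longrightarrow> j < 4 \<Longrightarrow> j \<noteq> Suc i \<Longrightarrow> i \<noteq> Suc j \<Longrightarrow> r i \<circ> r j = r j \<circ> r i"
  by (auto dest!: less_4_cases simp: r_apply[simplified] fun_eq_iff)

lemma r_fixes: "j < 4 \<Longrightarrow> i \<noteq> j \<Longrightarrow> r j x i = x i"
  by (auto dest!: less_4_cases simp: r_apply[simplified])

lemma words_fixes: "w \<in> words r I \<Longrightarrow> I \<subseteq> {..<4} \<Longrightarrow> i \<notin> I \<Longrightarrow> w x i = x i"
proof (induction rule: words.induct)
  case (step j w)
  then have "j < 4" "i \<noteq> j" by auto
  with step show ?case by (simp add: r_fixes)
qed simp

lemma minus_one_neq_one: "(-1::'a) \<noteq> 1" "(1::'a) \<noteq> -1"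
  using two by (metis add.right_inverse one_add_one)+

lemma r_moves: "j < 4 \<Longrightarrow> \<exists>x. r j x j \<noteq> x j"
proof -
  assume "j < 4"
  let ?x = "(\<lambda>_. 0)(j := 1) :: nat \<Rightarrow> 'a"
  have "r j ?x j = -1"
    using \<open>j < 4\<close> by (auto dest!: less_4_cases simp: r_apply[simplified])
  then show ?thesis
    using minus_one_neq_one by (metis fun_upd_same)
qed

text \<open>
  The generator of an isolated node \<open>j\<close> of \<open>I\<close> commutes with the rest, so an element of \<open>words r I\<close>
  either avoids \<open>r j\<close> or is \<open>h \<circ> r j\<close> with \<open>h\<close> avoiding it. In the latter case it moves the
  coordinate \<open>j\<close>, hence it can lie in \<open>words r J\<close> only if \<open>j \<in> J\<close>, and then \<open>h\<close> lies there too.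
\<close>

lemma Int_words_remove_isolated:
  assumes I: "I \<subseteq> {..<4}" and J: "J \<subseteq> {..<4}" and j: "j \<in> I"
    and iso: "\<And>i. i \<in> I \<Longrightarrow> j \<noteq> Suc i \<and> i \<noteq> Suc j"
    and rem: "words r (I - {j}) \<inter> words r J \<subseteq> words r ((I - {j}) \<inter> J)"
  shows "words r I \<inter> words r J \<subseteq> words r (I \<inter> J)"
proof
  fix w assume w: "w \<in> words r I \<inter> words r J"
  have j4: "j < 4" using I j by auto
  have "w \<in> words r (insert j (I - {j}))"
    using w j by (simp add: insert_absorb)
  then show "w \<in> words r (I \<inter> J)"
  proof (cases rule: words_insert_commuting)
    show "r i \<circ> r j = r j \<circ> r i" if "i \<in> I - {j}" for i
      using that I j4 iso by (intro r_commute) auto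
    show "r j \<circ> r j = id" using j4 by (rule r_involution)
    assume "w \<in> words r (I - {j})"
    then show ?thesis using w rem by (auto intro: words_mono)
  next
    fix h assume h: "h \<in> words r (I - {j})" and wh: "w = h \<circ> r j"
    have "j \<in> J"
    proof (rule ccontr)
      assume "j \<notin> J"
      then have "w x j = x j" for x
        using words_fixes[of w J j x] w J by auto
      moreover have "h y j = y j" for y
        using words_fixes[OF h, of j y] I by auto
      ultimately have "r j x j = x j" for x
        unfolding wh by simp
      then show False using r_moves[OF j4] by blast
    qed
    have "h = w \<circ> r j"
      using r_involution[OF j4] by (simp add: wh comp_assoc)
    then have "h \<in> words r J"
      using w \<open>j \<in> J\<close> by (auto intro: words_comp words_generator)
    then have "h \<in> words r ((I - {j}) \<inter> J)"
      using h rem by blast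
    then have "h \<in> words r (I \<inter> J)"
      by (rule words_mono) auto
    then show ?thesis
      unfolding wh using j \<open>j \<in> J\<close> by (auto intro: words_comp words_generator)
  qed
qed

text \<open>
  These are the unions of blocks of at least two consecutive nodes on a path with four nodes.
\<close>

lemma no_isolated_cases:
  assumes "I \<subseteq> {..<4::nat}" and "\<forall>j\<in>I. \<exists>i\<in>I. j = Suc i \<or> i = Suc j"
  shows "I \<in> {{}, {0,1}, {1,2}, {2,3}, {0,1,2}, {1,2,3}, {0,1,2,3}}"
proof -
  have "I \<in> Pow {0,1,2,3}"
    using assms(1) by (auto dest!: less_4_cases)
  then show ?thesis
    using assms(2) by (simp add: Pow_insert) (elim disjE; simp)
qed

text \<open>
  Splitting off isolated nodes leaves pairs of sets from the list above. The nested pairs are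
  trivial, \<open>{0,1}\<close> and \<open>{2,3}\<close> have no coordinate in common, and the pairs of a triple and a
  two-element block follow from the three remaining inclusions.
\<close>

lemma intersection_property_rank_4:
  assumes K1: "words r {0,1} \<inter> words r {1,2} \<subseteq> words r {1}"
    and K2: "words r {1,2} \<inter> words r {2,3} \<subseteq> words r {2}"
    and K3: "words r {0,1,2} \<inter> words r {1,2,3} \<subseteq> words r {1,2}"
  shows "intersection_property r {..<4}"
proof -
  let ?P = "\<lambda>I J. words r I \<inter> words r J \<subseteq> words r (I \<inter> J)"
  have K4: "words r {0,1} \<inter> words r {2,3} \<subseteq> {id}"
  proof
    fix w assume w: "w \<in> words r {0,1} \<inter> words r {2,3}"
    have "w x i = x i" for x i
    proof (cases "i \<in> {0,1}")
      case True
      then show ?thesis using words_fixes[of w "{2,3}" i x] w by auto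
    next
      case False
      then show ?thesis using words_fixes[of w "{0,1}" i x] w by auto
    qed
    then show "w \<in> {id}" by (auto simp: fun_eq_iff)
  qed
  have K5: "words r {0,1} \<inter> words r {1,2,3} \<subseteq> words r {1}"
  proof
    fix w assume w: "w \<in> words r {0,1} \<inter> words r {1,2,3}"
    then have "w \<in> words r {0,1,2}"
      by (auto intro: words_mono[of w r "{0,1}"])
    with w K1 K3 show "w \<in> words r {1}" by blast
  qed
  have K6: "words r {0,1,2} \<inter> words r {2,3} \<subseteq> words r {2}"
  proof
    fix w assume w: "w \<in> words r {0,1,2} \<inter> words r {2,3}"
    then have "w \<in> words r {1,2,3}"
      by (auto intro: words_mono[of w r "{2,3}"])
    with w K2 K3 show "w \<in> words r {2}" by blast
  qed
  have nested: "?P I J" if "I \<subseteq> J \<or> J \<subseteq> I" for I J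
    using that by (auto simp: Int_absorb1 Int_absorb2)
  have sym: "?P I J \<Longrightarrow> ?P J I" for I J
    by (simp add: Int_commute)
  have base: "?P I J"
    if "I \<in> {{}, {0,1}, {1,2}, {2,3}, {0,1,2}, {1,2,3}, {0,1,2,3}}"
      and "J \<in> {{}, {0,1}, {1,2}, {2,3}, {0,1,2}, {1,2,3}, {0,1,2,3}}" for I J
  proof (cases "I \<subseteq> J \<or> J \<subseteq> I")
    case True
    then show ?thesis by (rule nested)
  next
    case False
    have P: "?P {0,1} {1,2}" "?P {1,2} {2,3}" "?P {0,1,2} {1,2,3}"
      "?P {0,1} {2,3}" "?P {0,1} {1,2,3}" "?P {0,1,2} {2,3}"
      using K1 K2 K3 K4 K5 K6 by simp_all
    have "?P I J \<or> ?P J I"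
      using that False apply (simp only: insert_iff empty_iff)
      by (elim disjE; hypsubst?; (rule disjI1, rule P | rule disjI2, rule P | simp))
    with sym show ?thesis by blast
  qed
  have "?P I J" if "I \<subseteq> {..<4}" "J \<subseteq> {..<4}" for I J
    using that
  proof (induction "card I + card J" arbitrary: I J rule: less_induct)
    case less
    have fin: "finite I" "finite J"
      using less.prems by (auto intro: finite_subset)
    consider (I) j where "j \<in> I" "\<And>i. i \<in> I \<Longrightarrow> j \<noteq> Suc i \<and> i \<noteq> Suc j"
      | (J) j where "j \<in> J" "\<And>i. i \<in> J \<Longrightarrow> j \<noteq> Suc i \<and> i \<noteq> Suc j"
      | (none) "\<forall>j\<in>I. \<exists>i\<in>I. j = Suc i \<or> i = Suc j"
          "\<forall>j\<in>J. \<exists>i\<in>J. j = Suc i \<or> i = Suc j"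
      by blast
    then show ?case
    proof cases
      case (I j)
      have "card (I - {j}) < card I"
        using fin I by (intro card_Diff1_less)
      with less.prems have "?P (I - {j}) J"
        by (intro less.hyps) auto
      then show ?thesis
        using Int_words_remove_isolated[OF less.prems I(1)] I(2) by blast
    next
      case (J j)
      have "card (J - {j}) < card J"
        using fin J by (intro card_Diff1_less)
      with less.prems have "?P (J - {j}) I"
        by (intro less.hyps) auto
      then have "?P J I"
        using Int_words_remove_isolated[OF less.prems(2,1) J(1)] J(2) by blast
      then show ?thesis by (rule sym)
    next
      case none
      then show ?thesis
        using less.prems by (intro base no_isolated_cases)
    qed
  qed
  then show ?thesis
    unfolding intersection_property_def by blast
qed

section \<open>Intersections of dihedral subgroups\<close>

lemmas r_eval = r_apply[simplified] funpow_numeral fun_eq_iff algebra_simps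

lemma order_3_01:
  assumes "p = 1" "q = 1"
  shows "(r 0 \<circ> r 1) ^^ 3 = id"
  using assms by (auto simp: r_eval)

lemma order_4_01:
  assumes "p * q = 2"
  shows "(r 0 \<circ> r 1) ^^ 4 = id"
proof -
  have [simp]: "p * (q * x) = 2 * x" "q * (p * x) = 2 * x" for x
    using assms by (simp_all add: mult.assoc[symmetric] mult.commute)
  show ?thesis
    by (auto simp: r_eval)
qed

lemma order_4_12:
  assumes "s * t = 2"
  shows "(r 1 \<circ> r 2) ^^ 4 = id"
proof -
  have [simp]: "s * (t * x) = 2 * x" "t * (s * x) = 2 * x" for x
    using assms by (simp_all add: mult.assoc[symmetric] mult.commute)
  show ?thesis
    by (auto simp: r_eval)
qed

lemma order_6_12:
  assumes "s * t = 3"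
  shows "(r 1 \<circ> r 2) ^^ 6 = id"
proof -
  have [simp]: "s * (t * x) = 3 * x" "t * (s * x) = 3 * x" for x
    using assms by (simp_all add: mult.assoc[symmetric] mult.commute)
  show ?thesis
    by (auto simp: r_eval)
qed

text \<open>
  Elements of \<open>\<langle>r\<^sub>1, r\<^sub>2\<rangle>\<close> leave the coordinate 0 alone. In the nontrivial powers of \<open>r\<^sub>0 r\<^sub>1\<close> the
  output coordinate 0 either involves \<open>x\<^sub>1\<close> with coefficient \<open>p\<close> or \<open>- p\<close>, or is \<open>- x\<^sub>0\<close>
  up to further coordinates (the half turn of order 2).
\<close>

lemma Int_words_01_12:
  assumes "p = 1 \<and> q = 1 \<or> p * q = 2"
  shows "words r {0,1} \<inter> words r {1,2} \<subseteq> words r {1}"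
proof
  fix w assume w: "w \<in> words r {0,1} \<inter> words r {1,2}"
  have "p \<noteq> 0" using assms two by auto
  define n :: nat where "n = (if p = 1 \<and> q = 1 then 3 else 4)"
  have ord: "(r 0 \<circ> r 1) ^^ n = id" and "0 < n"
    using assms order_3_01 order_4_01 by (auto simp: n_def)
  obtain k where k: "k < n" "w = (r 0 \<circ> r 1) ^^ k \<or> w = r 1 \<circ> (r 0 \<circ> r 1) ^^ k"
    using w words_dihedral[of w r 0 1 n] ord \<open>0 < n\<close> r_involution by auto
  have fix0: "((r 0 \<circ> r 1) ^^ k) x 0 = x 0" for x
  proof -
    have "w x 0 = ((r 0 \<circ> r 1) ^^ k) x 0"
      using k(2) by (auto simp: r_eval)
    then show ?thesis
      using w words_fixes[of w "{1,2}" 0 x] by auto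
  qed
  have "k = 0"
  proof (rule ccontr)
    assume "k \<noteq> 0"
    with k(1) consider "n = 3" "k = 1 \<or> k = 2" | "n = 4" "k = 1 \<or> k = 2 \<or> k = 3"
      by (fastforce simp: n_def split: if_splits)
    then show False
    proof cases
      case 1
      then have "p = 1" "q = 1" by (auto simp: n_def split: if_splits)
      with 1 fix0[of "(\<lambda>_. 0)(1 := 1)"] show ?thesis
        by (auto simp: r_eval)
    next
      case 2
      then have "p * q = 2" using assms by (auto simp: n_def)
      then have pq: "p * (q * x) = 2 * x" "q * (p * x) = 2 * x" for x
        by (simp_all add: mult.assoc[symmetric] mult.commute)
      show ?thesis
        using 2 fix0[of "(\<lambda>_. 0)(0 := 1)"] fix0[of "(\<lambda>_. 0)(1 := 1)"] \<open>p \<noteq> 0\<close> minus_one_neq_one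
          \<open>p * q = 2\<close>
        by (auto simp: r_eval pq)
    qed
  qed
  with k(2) show "w \<in> words r {1}"
    by (auto intro: words.empty words_generator)
qed

text \<open>
  As before, with the coordinate 1, which elements of \<open>\<langle>r\<^sub>2, r\<^sub>3\<rangle>\<close> leave alone. The coefficient of
  \<open>x\<^sub>2\<close> in it is now \<open>s\<close> or \<open>- s\<close> except for the half turn, so \<open>s\<close> must not vanish.
\<close>

lemma Int_words_12_23:
  assumes "s * t = 2 \<or> s * t = 3 \<and> s \<noteq> 0"
  shows "words r {1,2} \<inter> words r {2,3} \<subseteq> words r {2}"
proof
  fix w assume w: "w \<in> words r {1,2} \<inter> words r {2,3}"
  have "s \<noteq> 0" using assms two by auto
  define n :: nat where "n = (if s * t = 2 then 4 else 6)"
  have ord: "(r 1 \<circ> r 2) ^^ n = id" and "0 < n"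
    using assms order_4_12 order_6_12 by (auto simp: n_def)
  obtain k where k: "k < n" "w = (r 1 \<circ> r 2) ^^ k \<or> w = r 2 \<circ> (r 1 \<circ> r 2) ^^ k"
    using w words_dihedral[of w r 1 2 n] ord \<open>0 < n\<close> r_involution by auto
  have fix1: "((r 1 \<circ> r 2) ^^ k) x 1 = x 1" for x
  proof -
    have "w x 1 = ((r 1 \<circ> r 2) ^^ k) x 1"
      using k(2) by (auto simp: r_eval)
    then show ?thesis
      using w words_fixes[of w "{2,3}" 1 x] by auto
  qed
  have "k = 0"
  proof (rule ccontr)
    assume "k \<noteq> 0"
    with k(1) consider "n = 4" "k = 1 \<or> k = 2 \<or> k = 3"
      | "n = 6" "k = 1 \<or> k = 2 \<or> k = 3 \<or> k = 4 \<or> k = 5"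
      by (fastforce simp: n_def split: if_splits)
    then show False
    proof cases
      case 1
      then have "s * t = 2" using assms by (auto simp: n_def split: if_splits)
      then have st: "s * (t * x) = 2 * x" "t * (s * x) = 2 * x" for x
        by (simp_all add: mult.assoc[symmetric] mult.commute)
      show ?thesis
        using 1 fix1[of "(\<lambda>_. 0)(1 := 1)"] fix1[of "(\<lambda>_. 0)(2 := 1)"] \<open>s \<noteq> 0\<close> minus_one_neq_one
          \<open>s * t = 2\<close>
        by (auto simp: r_eval st)
    next
      case 2
      then have "s * t = 3" using assms by (auto simp: n_def split: if_splits)
      then have st: "s * (t * x) = 3 * x" "t * (s * x) = 3 * x" for x
        by (simp_all add: mult.assoc[symmetric] mult.commute)
      show ?thesis
        using 2 fix1[of "(\<lambda>_. 0)(1 := 1)"] fix1[of "(\<lambda>_. 0)(2 := 1)"] \<open>s \<noteq> 0\<close> minus_one_neq_one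
          \<open>s * t = 3\<close>
        by (auto simp: r_eval st)
    qed
  qed
  with k(2) show "w \<in> words r {2}"
    by (auto intro: words.empty words_generator)
qed

text \<open>
  If \<open>s = 0\<close>, then \<open>(r\<^sub>1 r\<^sub>2)\<^sup>2\<close> is a transvection that leaves the coordinate 1 alone. Instead of
  coordinates it is now the basis vector \<open>e\<^sub>0\<close>, fixed by \<open>r\<^sub>2\<close> and \<open>r\<^sub>3\<close>, that detects the rotation: its six
  images under the powers of \<open>r\<^sub>1 r\<^sub>2\<close> are distinct because \<open>q\<close> and \<open>t\<close> do not vanish.
\<close>

lemma Int_words_12_23_degenerate:
  assumes "s = 0" "t \<noteq> 0" "q \<noteq> 0" and st: "s * t = 3"
  shows "words r {1,2} \<inter> words r {2,3} \<subseteq> words r {2}"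
proof
  fix w assume w: "w \<in> words r {1,2} \<inter> words r {2,3}"
  let ?e = "(\<lambda>_. 0)(0 := 1) :: nat \<Rightarrow> 'a"
  have fix_e: "g ?e = ?e" if "g \<in> words r {2,3}" for g
    using that by (induction rule: words.induct) (auto simp: r_eval)
  obtain k where k: "k < 6" "w = (r 1 \<circ> r 2) ^^ k \<or> w = r 2 \<circ> (r 1 \<circ> r 2) ^^ k"
    using w words_dihedral[of w r 1 2 6] order_6_12[OF st] r_involution by auto
  have "((r 1 \<circ> r 2) ^^ k) ?e = ?e"
    using k(2)
  proof
    assume "w = r 2 \<circ> (r 1 \<circ> r 2) ^^ k"
    then have "(r 1 \<circ> r 2) ^^ k = r 2 \<circ> w"
      using r_involution[of 2] by (simp add: comp_assoc[symmetric])
    then show ?thesis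
      using w fix_e[of "r 2 \<circ> w"] by (auto intro: words.step)
  qed (use w fix_e in auto)
  then have e: "((r 1 \<circ> r 2) ^^ k) ?e i = ?e i" for i
    by simp
  have "k = 0"
  proof (rule ccontr)
    assume "k \<noteq> 0"
    with k(1) have "k = 1 \<or> k = 2 \<or> k = 3 \<or> k = 4 \<or> k = 5"
      by linarith
    then show False
      using e[of 1] e[of 2] assms(1-3) two by (auto simp: r_eval)
  qed
  with k(2) show "w \<in> words r {2}"
    by (auto intro: words.empty words_generator)
qed

section \<open>Translations\<close>

text \<open>
  The family \<open>\<tau>\<close> plays the translation subgroup: \<open>r\<^sub>1\<close> and \<open>r\<^sub>2\<close> normalise it, and modulo it \<open>r\<^sub>0\<close> is an
  element of \<open>\<langle>r\<^sub>1, r\<^sub>2\<rangle>\<close>, so \<open>\<langle>r\<^sub>0, r\<^sub>1, r\<^sub>2\<rangle>\<close> is contained in the product of the two. The family may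
  contain more than the group does; only this inclusion matters.
\<close>

lemma Int_words_if_translations:
  assumes id: "\<tau> 0 0 = id"
    and s0: "\<And>a b. \<exists>a' b'. \<exists>d\<in>words r {1,2}. r 0 \<circ> \<tau> a b = \<tau> a' b' \<circ> d"
    and s1: "\<And>a b. \<exists>a' b'. r 1 \<circ> \<tau> a b = \<tau> a' b' \<circ> r 1"
    and s2: "\<And>a b. \<exists>a' b'. r 2 \<circ> \<tau> a b = \<tau> a' b' \<circ> r 2"
    and triv: "\<And>a b :: 'a. (\<And>x. \<tau> a b x 0 = x 0) \<Longrightarrow> \<tau> a b = id"
  shows "words r {0,1,2} \<inter> words r {1,2,3} \<subseteq> words r {1,2}"
proof
  have factor: "\<exists>a b. \<exists>d\<in>words r {1,2}. w = \<tau> a b \<circ> d" if "w \<in> words r {0,1,2}" for w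
    using that
  proof (induction rule: words.induct)
    case empty
    then show ?case
      using id words.empty by (metis comp_id)
  next
    case (step i w)
    then obtain a b d where d: "d \<in> words r {1,2}" and w: "w = \<tau> a b \<circ> d"
      by blast
    have "\<exists>a' b'. \<exists>d'\<in>words r {1,2}. r i \<circ> \<tau> a b = \<tau> a' b' \<circ> d'"
      using step.hyps(1) s0[of a b] s1[of a b] s2[of a b] words_generator[of _ "{1,2}" r] by blast
    then obtain a' b' d' where d': "d' \<in> words r {1,2}" "r i \<circ> \<tau> a b = \<tau> a' b' \<circ> d'"
      by blast
    have "r i \<circ> w = \<tau> a' b' \<circ> (d' \<circ> d)"
      by (metis w d'(2) comp_assoc)
    then show ?case
      using words_comp[OF d'(1) d] by blast
  qed
  fix w assume w: "w \<in> words r {0,1,2} \<inter> words r {1,2,3}"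
  then obtain a b d where d: "d \<in> words r {1,2}" and wd: "w = \<tau> a b \<circ> d"
    using factor by blast
  have "\<tau> a b x 0 = x 0" for x
  proof -
    have "surj d"
      using d by (rule words_surj) (auto intro!: r_involution)
    then obtain y where y: "x = d y" by (metis surjD)
    have "w y 0 = y 0" "d y 0 = y 0"
      using w d words_fixes[of w "{1,2,3}" 0 y] words_fixes[of d "{1,2}" 0 y] by auto
    then show ?thesis by (simp add: y wd)
  qed
  then have "\<tau> a b = id" by (rule triv)
  then show "w \<in> words r {1,2}" using d wd by simp
qed

text \<open>
  The vector \<open>c = (p, 2, t, 0)\<close> is fixed by \<open>r\<^sub>0, r\<^sub>1, r\<^sub>2\<close>. The vectors \<open>(p, 0, 0, 0)\<close> and \<open>(p, 2, 0, 0)\<close>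
  are orthogonal for a suitably scaled invariant form, and \<open>q x\<^sub>0 - x\<^sub>1\<close> and \<open>x\<^sub>1 - s x\<^sub>2\<close> are the
  inner products with them. Let \<open>w\<close> be their combination with coefficients \<open>a\<close> and \<open>b\<close>. The map is
  the Siegel transformation \<open>x \<mapsto> x + (x, w) c + h w + (w, w) h c / 2\<close>, where \<open>h\<close>, a multiple of \<open>x\<^sub>3\<close>,
  stands for \<open>- (x, c)\<close>. The term in \<open>h\<close> makes the formula right outside the span of
  \<open>b\<^sub>0, b\<^sub>1, b\<^sub>2\<close>.
\<close>

definition translation_44 :: "'a \<Rightarrow> 'a \<Rightarrow> (nat \<Rightarrow> 'a) \<Rightarrow> nat \<Rightarrow> 'a" where
  "translation_44 a b x =
    (let h = s * u / 2 * x 3; f = a * (q * x 0 - x 1) + b * (x 1 - s * x 2) + h * (a\<^sup>2 + b\<^sup>2)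
     in x(0 := x 0 + p * f + h * p * (a + b), 1 := x 1 + 2 * f + 2 * h * b, 2 := x 2 + t * f))"

text \<open>
  On the parameters \<open>(a, b)\<close> the point group acts as the symmetries of the square: \<open>r\<^sub>1\<close> swaps the
  coordinates, \<open>r\<^sub>2\<close> negates \<open>b\<close>, and \<open>r\<^sub>0\<close> is the translation \<open>(1, 0)\<close> after \<open>r\<^sub>1 r\<^sub>2 r\<^sub>1\<close>, which negates
  \<open>a\<close>.
\<close>

lemma Int_words_012_123_44:
  assumes pq: "p * q = 2" and st: "s * t = 2"
  shows "words r {0,1,2} \<inter> words r {1,2,3} \<subseteq> words r {1,2}"
proof (rule Int_words_if_translations[where \<tau> = translation_44])
  have pqx: "p * (q * x) = 2 * x" "q * (p * x) = 2 * x" "s * (t * x) = 2 * x" "t * (s * x) = 2 * x" for x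
    using pq st by (simp_all add: mult.assoc[symmetric] mult.commute)
  define h where "h = s * u / 2"
  have hx: "s * (u * x) = 2 * (h * x)" for x
    using two by (simp add: h_def)
  have ht: "h * t = u"
    using two st by (simp add: h_def mult.commute mult.left_commute)
  note eval = translation_44_def ht h_def[symmetric] Let_def r_eval pqx hx pq st power2_eq_square
  show "translation_44 0 0 = id"
    by (simp add: translation_44_def fun_eq_iff)
  fix a b
  have "r 1 \<circ> translation_44 a b = translation_44 b a \<circ> r 1"
    by (auto simp: eval)
  then show "\<exists>a' b'. r 1 \<circ> translation_44 a b = translation_44 a' b' \<circ> r 1" by blast
  have "r 2 \<circ> translation_44 a b = translation_44 a (-b) \<circ> r 2"
    by (auto simp: eval)
  then show "\<exists>a' b'. r 2 \<circ> translation_44 a b = translation_44 a' b' \<circ> r 2" by blast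
  have "r 0 \<circ> translation_44 a b = translation_44 (1 - a) b \<circ> (r 1 \<circ> r 2 \<circ> r 1)"
    by (auto simp: eval)
  moreover have "r 1 \<circ> r 2 \<circ> r 1 \<in> words r {1,2}"
    by (intro words_comp words_generator) auto
  ultimately show "\<exists>a' b'. \<exists>d\<in>words r {1,2}. r 0 \<circ> translation_44 a b = translation_44 a' b' \<circ> d"
    by blast
next
  fix a b assume fix0: "\<And>x. translation_44 a b x 0 = x 0"
  have nz: "p \<noteq> 0" "s \<noteq> 0" using pq st two by auto
  have "b = 0"
    using fix0[of "(\<lambda>_. 0)(2 := 1)"] nz by (auto simp: translation_44_def Let_def)
  moreover have "a = b"
    using fix0[of "(\<lambda>_. 0)(1 := 1)"] nz by (auto simp: translation_44_def Let_def)
  ultimately show "translation_44 a b = id"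
    by (simp add: translation_44_def fun_eq_iff)
qed

text \<open>
  The same construction for \<open>[3, 6]\<close>, with \<open>c = (1, 2, t, 0)\<close> and \<open>w = (a, b, 0, 0)\<close>. The
  quadratic form is \<open>a\<^sup>2 - a b + b\<^sup>2\<close>, that of the hexagonal lattice. With coordinates relative to
  \<open>b\<^sub>0\<close> and \<open>b\<^sub>1\<close> the formula needs no division by 3, \<open>s\<close> or \<open>t\<close>, each of which may vanish.
\<close>

definition translation_36 :: "'a \<Rightarrow> 'a \<Rightarrow> (nat \<Rightarrow> 'a) \<Rightarrow> nat \<Rightarrow> 'a" where
  "translation_36 a b x =
    (let h = s * u * x 3;
         f = a * (2 * x 0 - x 1) + b * (2 * x 1 - x 0 - s * x 2) + h * (a\<^sup>2 - a * b + b\<^sup>2)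
     in x(0 := x 0 + f + h * a, 1 := x 1 + 2 * f + h * b, 2 := x 2 + t * f))"

text \<open>
  On the parameters \<open>(a, b)\<close> the point group acts as the symmetries of the hexagonal lattice, and
  \<open>r\<^sub>0\<close> is the translation \<open>(1, 0)\<close> after the reflection \<open>r\<^sub>1 r\<^sub>2 r\<^sub>1 r\<^sub>2 r\<^sub>1\<close>, which negates \<open>(1, 0)\<close>. A
  translation that leaves the coordinate 0 alone has \<open>a = 2 b\<close> and \<open>b s = 0\<close>.
\<close>

lemma Int_words_012_123_36:
  assumes p: "p = 1" and q: "q = 1" and st: "s * t = 3"
  shows "words r {0,1,2} \<inter> words r {1,2,3} \<subseteq> words r {1,2}"
proof (rule Int_words_if_translations[where \<tau> = translation_36])
  have stx: "s * (t * x) = 3 * x" "t * (s * x) = 3 * x" for x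
    using st by (simp_all add: mult.assoc[symmetric] mult.commute)
  note eval = translation_36_def Let_def r_eval p q stx st power2_eq_square
  show "translation_36 0 0 = id"
    by (simp add: translation_36_def fun_eq_iff)
  fix a b
  have "r 1 \<circ> translation_36 a b = translation_36 a (a - b) \<circ> r 1"
    by (auto simp: eval)
  then show "\<exists>a' b'. r 1 \<circ> translation_36 a b = translation_36 a' b' \<circ> r 1" by blast
  have "r 2 \<circ> translation_36 a b = translation_36 (a - b) (-b) \<circ> r 2"
    by (auto simp: eval)
  then show "\<exists>a' b'. r 2 \<circ> translation_36 a b = translation_36 a' b' \<circ> r 2" by blast
  have "r 0 \<circ> translation_36 a b = translation_36 (1 + b - a) b \<circ> (r 1 \<circ> r 2 \<circ> r 1 \<circ> r 2 \<circ> r 1)"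
    by (auto simp: eval)
  moreover have "r 1 \<circ> r 2 \<circ> r 1 \<circ> r 2 \<circ> r 1 \<in> words r {1,2}"
    by (intro words_comp words_generator) auto
  ultimately show "\<exists>a' b'. \<exists>d\<in>words r {1,2}. r 0 \<circ> translation_36 a b = translation_36 a' b' \<circ> d"
    by blast
next
  fix a b assume fix0: "\<And>x. translation_36 a b x 0 = x 0"
  have a: "a = 2 * b"
    using fix0[of "(\<lambda>_. 0)(1 := 1)"] by (auto simp: translation_36_def Let_def algebra_simps)
  have sb: "s = 0 \<or> b = 0"
    using fix0[of "(\<lambda>_. 0)(2 := 1)"] by (auto simp: translation_36_def Let_def)
  have "translation_36 a b x = x" for x
  proof (cases "b = 0")
    case False
    \<comment> \<open>Here the characteristic is 3 and \<open>s\<close> vanishes, so the translations along \<open>(2, 1)\<close> are trivial.\<close>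
    then have "s = 0" "(3::'a) = 0" using sb st by auto
    then have "(4::'a) = 1"
      by (metis add.right_neutral numeral_One numeral_plus_numeral add_num_simps)
    then show ?thesis
      using \<open>(4::'a) = 1\<close> \<open>s = 0\<close> a unfolding translation_36_def by (simp add: Let_def algebra_simps)
  qed (simp add: a translation_36_def)
  then show "translation_36 a b = id"
    by (simp add: fun_eq_iff)
qed

section \<open>The intersection property next to an affine subdiagram\<close>

lemma intersection_property_if_affine:
  assumes "affine_entries p q s t"
  shows "intersection_property r {..<4}"
proof (rule intersection_property_rank_4)
  show "words r {0,1} \<inter> words r {1,2} \<subseteq> words r {1}"
    using assms by (intro Int_words_01_12) (auto simp: affine_entries_def)
  show "words r {1,2} \<inter> words r {2,3} \<subseteq> words r {2}"
  proof (cases "s = 0")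
    case True
    moreover have "t \<noteq> 0" "q \<noteq> 0" "s * t = 3"
      using True assms two by (auto simp: affine_entries_def)
    ultimately show ?thesis by (rule Int_words_12_23_degenerate)
  next
    case False
    then show ?thesis using assms by (intro Int_words_12_23) (auto simp: affine_entries_def)
  qed
  show "words r {0,1,2} \<inter> words r {1,2,3} \<subseteq> words r {1,2}"
    using assms Int_words_012_123_44 Int_words_012_123_36 by (auto simp: affine_entries_def)
qed

lemma string_reflections_reversed:
  "string_reflections (\<lambda>i. reverse_coords \<circ> r (3 - i) \<circ> reverse_coords) v u t s q p"
proof
qed (auto simp: fun_eq_iff reverse_coords_def r_apply[simplified] two)

lemma intersection_property_if_affine_or_reversed:
  assumes "affine_entries p q s t \<or> affine_entries v u t s"
  shows "intersection_property r {..<4}"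
  using assms
proof
  assume "affine_entries v u t s"
  interpret reversed: string_reflections "\<lambda>i. reverse_coords \<circ> r (3 - i) \<circ> reverse_coords" v u t s q p
    by (rule string_reflections_reversed)
  have img: "(\<lambda>i. 3 - i) ` {..<4} = {..<4::nat}"
  proof (intro equalityI subsetI)
    fix i :: nat assume "i \<in> {..<4}"
    then have "i = 3 - (3 - i)" "3 - i \<in> {..<4}" by auto
    then show "i \<in> (\<lambda>i. 3 - i) ` {..<4}" by (rule image_eqI)
  qed auto
  show ?thesis
  proof (rule intersection_property_conjugate)
    show "intersection_property (\<lambda>i. reverse_coords \<circ> r (3 - i) \<circ> reverse_coords) ((\<lambda>i. 3 - i) ` {..<4})"
      unfolding img by (rule reversed.intersection_property_if_affine) fact
    show "inj_on (\<lambda>i. 3 - i) {..<4::nat}"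
      by (auto simp: inj_on_def)
    show "reverse_coords (reverse_coords x) = x" for x :: "nat \<Rightarrow> 'a"
      by (auto simp: fun_eq_iff reverse_coords_def)
  qed auto
qed (rule intersection_property_if_affine)

end

section \<open>From matrices to maps\<close>

text \<open>
  A generated subgroup is closed under inverses, but an involution is its own inverse, so a
  homomorphism into maps sends the subgroup exactly to the words.
\<close>

lemma words_eq_image_generate:
  assumes "group G" and r: "\<And>i. i \<in> I \<Longrightarrow> r i \<in> carrier G"
    and inv: "\<And>i. i \<in> I \<Longrightarrow> r i \<otimes>\<^bsub>G\<^esub> r i = \<one>\<^bsub>G\<^esub>"
    and one: "\<phi> \<one>\<^bsub>G\<^esub> = id"
    and mult: "\<And>x y. x \<in> carrier G \<Longrightarrow> y \<in> carrier G \<Longrightarrow> \<phi> (x \<otimes>\<^bsub>G\<^esub> y) = \<phi> x \<circ> \<phi> y"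
  shows "words (\<lambda>i. \<phi> (r i)) I = \<phi> ` generate G (r ` I)"
proof
  interpret group G by fact
  have carr: "generate G (r ` I) \<subseteq> carrier G"
    using r by (intro generate_incl) auto
  have inv_r: "inv\<^bsub>G\<^esub> r i = r i" if "i \<in> I" for i
    using inv r that by (intro inv_equality) auto
  show "words (\<lambda>i. \<phi> (r i)) I \<subseteq> \<phi> ` generate G (r ` I)"
  proof
    fix w assume "w \<in> words (\<lambda>i. \<phi> (r i)) I"
    then show "w \<in> \<phi> ` generate G (r ` I)"
    proof (induction rule: words.induct)
      case empty
      show ?case using one generate.one[of G "r ` I"] by (metis imageI)
    next
      case (step i w)
      then obtain g where g: "g \<in> generate G (r ` I)" "w = \<phi> g" by blast
      have "r i \<otimes>\<^bsub>G\<^esub> g \<in> generate G (r ` I)"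
        using g step.hyps by (intro generate.eng generate.incl[of "r i"]) auto
      moreover have "\<phi> (r i) \<circ> w = \<phi> (r i \<otimes>\<^bsub>G\<^esub> g)"
        using g carr step.hyps r by (subst mult) auto
      ultimately show ?case by blast
    qed
  qed
  have "\<phi> g \<in> words (\<lambda>i. \<phi> (r i)) I" if "g \<in> generate G (r ` I)" for g
    using that
  proof (induction rule: generate.induct)
    case one
    then show ?case using \<open>\<phi> \<one>\<^bsub>G\<^esub> = id\<close> words.empty by metis
  next
    case (incl h)
    then show ?case using words_generator[where r = "\<lambda>i. \<phi> (r i)"] by auto
  next
    case (inv h)
    then show ?case using words_generator[where r = "\<lambda>i. \<phi> (r i)"] inv_r by auto
  next
    case (eng g h)
    then show ?case using carr by (subst mult) (auto intro: words_comp)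
  qed
  then show "\<phi> ` generate G (r ` I) \<subseteq> words (\<lambda>i. \<phi> (r i)) I" by blast
qed

lemma C_group_if_intersection_property:
  assumes "group G" and r: "\<And>i. i < n \<Longrightarrow> r i \<in> carrier G"
    and inv: "\<And>i. i < n \<Longrightarrow> r i \<otimes>\<^bsub>G\<^esub> r i = \<one>\<^bsub>G\<^esub>"
    and one: "\<phi> \<one>\<^bsub>G\<^esub> = id"
    and mult: "\<And>x y. x \<in> carrier G \<Longrightarrow> y \<in> carrier G \<Longrightarrow> \<phi> (x \<otimes>\<^bsub>G\<^esub> y) = \<phi> x \<circ> \<phi> y"
    and inj: "inj_on \<phi> (carrier G)"
    and ip: "intersection_property (\<lambda>i. \<phi> (r i)) {..<n}"
  shows "C_group (G\<lparr>carrier := generate G (r ` {..<n})\<rparr>) r n"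
  unfolding C_group_def
proof (intro allI impI)
  interpret group G by fact
  fix I J assume IJ: "I \<subseteq> {..<n}" "J \<subseteq> {..<n}"
  have sub: "subgroup (generate G (r ` {..<n})) G"
    using r by (intro generate_is_subgroup) auto
  have cons: "generate (G\<lparr>carrier := generate G (r ` {..<n})\<rparr>) (r ` K) = generate G (r ` K)"
    if "K \<subseteq> {..<n}" for K
    using that by (intro generate_consistent[OF _ sub]) (auto intro: generate.incl)
  have carr: "generate G (r ` K) \<subseteq> carrier G" if "K \<subseteq> {..<n}" for K
    using that r by (intro generate_incl) auto
  have words: "words (\<lambda>i. \<phi> (r i)) K = \<phi> ` generate G (r ` K)" if "K \<subseteq> {..<n}" for K
    using that r inv one mult by (intro words_eq_image_generate \<open>group G\<close>) auto
  have "generate G (r ` I) \<inter> generate G (r ` J) = generate G (r ` (I \<inter> J))"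
  proof
    show "generate G (r ` (I \<inter> J)) \<subseteq> generate G (r ` I) \<inter> generate G (r ` J)"
      by (intro Int_greatest mono_generate) auto
    show "generate G (r ` I) \<inter> generate G (r ` J) \<subseteq> generate G (r ` (I \<inter> J))"
    proof
      fix g assume g: "g \<in> generate G (r ` I) \<inter> generate G (r ` J)"
      then have "\<phi> g \<in> words (\<lambda>i. \<phi> (r i)) I \<inter> words (\<lambda>i. \<phi> (r i)) J"
        using IJ words by blast
      then have "\<phi> g \<in> words (\<lambda>i. \<phi> (r i)) (I \<inter> J)"
        using ip IJ unfolding intersection_property_def by blast
      then have "\<phi> g \<in> \<phi> ` generate G (r ` (I \<inter> J))"
        using IJ words[of "I \<inter> J"] by blast
      then show "g \<in> generate G (r ` (I \<inter> J))"
        using inj_on_image_mem_iff[OF inj, of g] g carr IJ by (meson IntD1 le_infI1 subsetD)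
    qed
  qed
  moreover have "I \<inter> J \<subseteq> {..<n}" using IJ by blast
  ultimately show "generate (G\<lparr>carrier := generate G (r ` {..<n})\<rparr>) (r ` I) \<inter>
      generate (G\<lparr>carrier := generate G (r ` {..<n})\<rparr>) (r ` J) =
      generate (G\<lparr>carrier := generate G (r ` {..<n})\<rparr>) (r ` (I \<inter> J))"
    using cons IJ by metis
qed

text \<open>
  Coordinates beyond the matrix are left alone, so that the identity matrix becomes \<open>id\<close>.
\<close>

definition mat_map :: "'a::comm_ring_1 mat \<Rightarrow> (nat \<Rightarrow> 'a) \<Rightarrow> nat \<Rightarrow> 'a" where
  "mat_map A x i = (if i < dim_row A then \<Sum>j<dim_col A. A $$ (i, j) * x j else x i)"

lemma mat_map_mult:
  assumes "A \<in> carrier_mat n n" "A' \<in> carrier_mat n n"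
  shows "mat_map (A * A') = mat_map A \<circ> mat_map A'"
proof (intro ext)
  fix x i
  show "mat_map (A * A') x i = (mat_map A \<circ> mat_map A') x i"
  proof (cases "i < n")
    case True
    have "mat_map (A * A') x i = (\<Sum>j<n. \<Sum>k<n. A $$ (i, k) * A' $$ (k, j) * x j)"
      using assms True
      by (auto simp: mat_map_def scalar_prod_def sum_distrib_right atLeast0LessThan intro!: sum.cong)
    also have "\<dots> = (\<Sum>k<n. \<Sum>j<n. A $$ (i, k) * A' $$ (k, j) * x j)"
      by (rule sum.swap)
    also have "\<dots> = (mat_map A \<circ> mat_map A') x i"
      using assms True by (auto simp: mat_map_def sum_distrib_left mult.assoc intro!: sum.cong)
    finally show ?thesis .
  qed (use assms in \<open>simp add: mat_map_def\<close>)
qed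

lemma inj_on_mat_map: "inj_on mat_map (carrier_mat n n)"
proof (rule inj_onI)
  fix A A' :: "'a mat"
  assume A: "A \<in> carrier_mat n n" "A' \<in> carrier_mat n n" and eq: "mat_map A = mat_map A'"
  have entry: "mat_map C (\<lambda>k. if k = j then 1 else 0) i = C $$ (i, j)"
    if "C \<in> carrier_mat n n" "i < n" "j < n" for C :: "'a mat" and i j
    using that by (simp add: mat_map_def if_distrib cong: if_cong)
  show "A = A'"
    using A by (intro eq_matI) (metis carrier_matD entry eq)+
qed

definition reflection_map ::
    "(nat \<Rightarrow> nat \<Rightarrow> 'a::comm_ring_1) \<Rightarrow> nat \<Rightarrow> nat \<Rightarrow> (nat \<Rightarrow> 'a) \<Rightarrow> nat \<Rightarrow> 'a" where
  "reflection_map c n k x = x(k := x k - (\<Sum>j<n. c k j * x j))"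

lemma reflection_map_involution:
  assumes "k < n" and "c k k = 2"
  shows "reflection_map c n k \<circ> reflection_map c n k = id"
proof (intro ext)
  fix x i
  let ?a = "\<Sum>j<n. c k j * x j"
  have "(\<Sum>j<n. c k j * (x(k := x k - ?a)) j) = (\<Sum>j<n. c k j * x j - (if j = k then c k k * ?a else 0))"
    by (intro sum.cong) (auto simp: algebra_simps)
  also have "\<dots> = ?a - 2 * ?a"
    using assms by (simp add: sum_subtractf)
  finally show "(reflection_map c n k \<circ> reflection_map c n k) x i = id x i"
    unfolding reflection_map_def by auto
qed

section \<open>Cartan integers of a basic system\<close>

definition cartan_entry :: "('v::real_vector \<Rightarrow> 'v \<Rightarrow> real) \<Rightarrow> (nat \<Rightarrow> 'v) \<Rightarrow> nat \<Rightarrow> nat \<Rightarrow> int" where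
  "cartan_entry B b i j = \<lfloor>2 * B (b i) (b j) / B (b i) (b i)\<rfloor>"

lemma of_int_cartan_entry:
  assumes "basic_system ps B b" "i \<le> length ps" "j \<le> length ps"
  shows "real_of_int (cartan_entry B b i j) = 2 * B (b i) (b j) / B (b i) (b i)"
  using assms unfolding basic_system_def cartan_entry_def by (metis of_int_floor_cancel Ints_cases floor_of_int)

lemma cartan_entry_diag:
  assumes "basic_system ps B b" "i \<le> length ps"
  shows "cartan_entry B b i i = 2"
proof -
  have "0 < B (b i) (b i)"
    using assms unfolding basic_system_def by blast
  then show ?thesis
    by (simp add: cartan_entry_def)
qed

lemma reflection_matrix_entry:
  assumes bs: "basic_system ps B b" and n: "n = Suc (length ps)"
    and less: "i < n" "j < n" "k < n"
  shows "reflection_matrix B b n k $$ (i, j) =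
    (if i = j then 1 else 0) - (if i = k then cartan_entry B b k j else 0)"
proof -
  let ?S = "b ` {..<n}"
  have S: "{..<n} = {..length ps}"
    using n by (simp add: lessThan_Suc_atMost)
  have ind: "independent ?S" and inj: "inj_on b {..<n}"
    and sym: "B (b j) (b k) = B (b k) (b j)"
    using bs unfolding basic_system_def S by blast+
  have rep: "representation ?S (b m) (b i) = (if i = m then 1 else 0)" if "m < n" for m
    using that less inj by (auto simp: real_vector.representation_basis[OF ind] dest: inj_onD)
  have mem: "b j \<in> span ?S" "b k \<in> span ?S"
    using less by (auto intro: span_base)
  have "representation ?S (root_reflection B (b k) (b j)) (b i) =
      representation ?S (b j) (b i)
        - 2 * B (b k) (b j) / B (b k) (b k) * representation ?S (b k) (b i)"
    unfolding root_reflection_def sym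
    using mem by (simp add: real_vector.representation_diff[OF ind]
        real_vector.representation_scale[OF ind] span_scale)
  also have "\<dots> = real_of_int ((if i = j then 1 else 0) - (if i = k then cartan_entry B b k j else 0))"
    using rep[OF less(2)] rep[OF less(3)] of_int_cartan_entry[OF bs, of k j] less n
    by (simp only: of_int_diff of_int_0 of_int_1 if_distrib[of real_of_int]) simp
  finally show ?thesis
    using of_int_reflection_matrix[OF bs n less] by linarith
qed

lemma mat_map_reduced_reflection:
  assumes bs: "basic_system ps B b" and n: "n = Suc (length ps)" and k: "k < n"
  shows "mat_map (reduced_reflection B b n k :: 'p::prime_card mod_ring mat) =
    reflection_map (\<lambda>i j. of_int (cartan_entry B b i j)) n k"
proof (intro ext)
  fix x :: "nat \<Rightarrow> 'p mod_ring" and i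
  let ?c = "\<lambda>i j. of_int (cartan_entry B b i j) :: 'p mod_ring"
  have dim: "dim_row (reflection_matrix B b n k) = n" "dim_col (reflection_matrix B b n k) = n"
    by (simp_all add: reflection_matrix_def)
  show "mat_map (reduced_reflection B b n k) x i = reflection_map ?c n k x i"
  proof (cases "i < n")
    case True
    have "mat_map (reduced_reflection B b n k) x i =
        (\<Sum>j<n. (if i = j then x j else 0) - (if i = k then ?c k j * x j else 0))"
      using True k
      by (auto simp: mat_map_def reduced_reflection_def dim reflection_matrix_entry[OF bs n] algebra_simps
          intro!: sum.cong)
    also have "\<dots> = reflection_map ?c n k x i"
      using True by (simp add: sum_subtractf reflection_map_def)
    finally show ?thesis .
  qed (use k in \<open>auto simp: mat_map_def reduced_reflection_def dim reflection_map_def\<close>)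
qed

lemma reduced_group_C_group:
  assumes bs: "basic_system ps B b" and n: "n = Suc (length ps)"
    and ip: "intersection_property
      (reflection_map (\<lambda>i j. of_int (cartan_entry B b i j) :: 'p::prime_card mod_ring) n) {..<n}"
  shows "C_group (reduced_group B b n) (reduced_reflection B b n :: nat \<Rightarrow> 'p mod_ring mat) n"
proof -
  let ?M = "ring_mat TYPE('p mod_ring) n ()"
  let ?G = "general_linear_group n :: 'p mod_ring mat monoid"
  let ?R = "reduced_reflection B b n :: nat \<Rightarrow> 'p mod_ring mat"
  interpret M: ring ?M by (rule ring_mat)
  note GL = general_linear_group_def units_of_carrier units_of_mult units_of_one ring_mat_simps
  have carr: "carrier ?G \<subseteq> carrier_mat n n"
    by (auto simp: GL Units_def)
  have R_mat: "?R k \<in> carrier_mat n n" for k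
    by (simp add: reduced_reflection_def reflection_matrix_def)
  have one_map: "mat_map (1\<^sub>m n :: 'p mod_ring mat) = id"
  proof (intro ext)
    fix x i
    have "(\<Sum>j<n. (1\<^sub>m n :: 'p mod_ring mat) $$ (i, j) * x j) = (\<Sum>j<n. if i = j then x j else 0)"
      if "i < n"
      using that by (intro sum.cong) auto
    then show "mat_map (1\<^sub>m n :: 'p mod_ring mat) x i = id x i"
      by (simp add: mat_map_def)
  qed
  have invol: "?R k * ?R k = 1\<^sub>m n" if "k < n" for k
  proof -
    have "k \<le> length ps" using that n by simp
    then have "mat_map (?R k * ?R k) = mat_map (1\<^sub>m n)"
      unfolding mat_map_mult[OF R_mat R_mat] mat_map_reduced_reflection[OF bs n that] one_map
      using that by (intro reflection_map_involution) (simp_all add: cartan_entry_diag[OF bs])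
    then show ?thesis
      by (rule inj_onD[OF inj_on_mat_map]) (use mult_carrier_mat[OF R_mat R_mat] in auto)
  qed
  show ?thesis
    unfolding reduced_group_def
  proof (rule C_group_if_intersection_property[where \<phi> = mat_map])
    show "group ?G" unfolding general_linear_group_def by (rule M.units_group)
    show "?R k \<in> carrier ?G" if "k < n" for k
      using R_mat[of k] invol[OF that] by (auto simp: GL Units_def)
    show "?R k \<otimes>\<^bsub>?G\<^esub> ?R k = \<one>\<^bsub>?G\<^esub>" if "k < n" for k
      using invol[OF that] by (simp add: GL)
    show "mat_map \<one>\<^bsub>?G\<^esub> = id" by (simp add: GL one_map)
    show "mat_map (X \<otimes>\<^bsub>?G\<^esub> Y) = mat_map X \<circ> mat_map Y" if "X \<in> carrier ?G" "Y \<in> carrier ?G" for X Y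
      using that carr mat_map_mult[of X n Y] by (auto simp: GL)
    show "inj_on mat_map (carrier ?G)"
      using inj_on_mat_map carr by (rule inj_on_subset)
    show "intersection_property (\<lambda>k. mat_map (?R k)) {..<n}"
      using ip mat_map_reduced_reflection[OF bs n]
      by (subst intersection_property_cong) auto
  qed
qed

lemma basic_system_cartan_product:
  assumes bs: "basic_system ps B b" and i: "i < length ps"
  shows "real_of_int (cartan_entry B b i (Suc i) * cartan_entry B b (Suc i) i) = 4 * (cos_mark (ps ! i))\<^sup>2"
    and "0 \<le> cos_mark (ps ! i) \<Longrightarrow> cartan_entry B b i (Suc i) \<le> 0"
    and "0 \<le> cos_mark (ps ! i) \<Longrightarrow> cartan_entry B b (Suc i) i \<le> 0"
proof -
  let ?N = "B (b i) (b i)" and ?N' = "B (b (Suc i)) (b (Suc i))"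
  have pos: "0 < ?N" "0 < ?N'"
    and off: "B (b i) (b (Suc i)) = - cos_mark (ps ! i) * sqrt (?N * ?N')"
    and sym: "B (b (Suc i)) (b i) = B (b i) (b (Suc i))"
    using bs i unfolding basic_system_def by auto
  have c: "real_of_int (cartan_entry B b i (Suc i)) = - 2 * cos_mark (ps ! i) * sqrt (?N * ?N') / ?N"
    "real_of_int (cartan_entry B b (Suc i) i) = - 2 * cos_mark (ps ! i) * sqrt (?N * ?N') / ?N'"
    using i by (simp_all add: of_int_cartan_entry[OF bs] sym off)
  have "real_of_int (cartan_entry B b i (Suc i) * cartan_entry B b (Suc i) i)
      = 4 * (cos_mark (ps ! i))\<^sup>2 * (sqrt (?N * ?N'))\<^sup>2 / (?N * ?N')"
    by (simp add: c power2_eq_square)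
  then show "real_of_int (cartan_entry B b i (Suc i) * cartan_entry B b (Suc i) i) = 4 * (cos_mark (ps ! i))\<^sup>2"
    using pos by simp
  assume "0 \<le> cos_mark (ps ! i)"
  then have "real_of_int (cartan_entry B b i (Suc i)) \<le> 0" "real_of_int (cartan_entry B b (Suc i) i) \<le> 0"
    unfolding c using pos by (simp_all add: divide_le_0_iff mult_nonneg_nonneg)
  then show "cartan_entry B b i (Suc i) \<le> 0" "cartan_entry B b (Suc i) i \<le> 0"
    by simp_all
qed

lemma basic_system_cartan_far:
  assumes bs: "basic_system ps B b" and ij: "i + 2 \<le> j" "j \<le> length ps"
  shows "cartan_entry B b i j = 0" and "cartan_entry B b j i = 0"
proof -
  have "B (b i) (b j) = 0" "B (b j) (b i) = 0"
    using bs ij unfolding basic_system_def by metis+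
  then show "cartan_entry B b i j = 0" "cartan_entry B b j i = 0"
    by (simp_all add: cartan_entry_def)
qed

text \<open>
  Completing squares, the form of \<open>[k, l]\<close> with cosines \<open>c\<close> and \<open>d\<close> is
  \<open>(x\<^sub>0 - c x\<^sub>1)\<^sup>2 + (x\<^sub>2 - d x\<^sub>1)\<^sup>2 + (1 - c\<^sup>2 - d\<^sup>2) x\<^sub>1\<^sup>2\<close>. It is semidefinite but not definite exactly if
  the last coefficient vanishes.
\<close>

lemma euclidean_coxeter_rank_3:
  assumes "euclidean_coxeter [k, l]"
  shows "(cos_mark k)\<^sup>2 + (cos_mark l)\<^sup>2 = 1"
proof -
  let ?c = "cos_mark k" and ?d = "cos_mark l"
  have form: "coxeter_form [k, l] x =
      (x 0 - ?c * x 1)\<^sup>2 + (x 2 - ?d * x 1)\<^sup>2 + (1 - ?c\<^sup>2 - ?d\<^sup>2) * (x 1)\<^sup>2" for x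
    by (simp add: coxeter_form_def coxeter_gram_def power2_eq_square algebra_simps numeral_2_eq_2)
  have "0 \<le> coxeter_form [k, l] ((\<lambda>_. 0)(0 := ?c, 1 := 1, 2 := ?d))"
    using assms unfolding euclidean_coxeter_def by blast
  then have nonneg: "0 \<le> 1 - ?c\<^sup>2 - ?d\<^sup>2"
    unfolding form by simp
  obtain x i where x: "i \<le> 2" "x i \<noteq> 0" "coxeter_form [k, l] x = 0"
    using assms unfolding euclidean_coxeter_def by (auto simp: numeral_2_eq_2)
  have "1 - ?c\<^sup>2 - ?d\<^sup>2 = 0"
  proof (rule ccontr)
    assume "1 - ?c\<^sup>2 - ?d\<^sup>2 \<noteq> 0"
    with nonneg have pos: "0 < 1 - ?c\<^sup>2 - ?d\<^sup>2" by simp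
    have "0 \<le> (1 - ?c\<^sup>2 - ?d\<^sup>2) * (x 1)\<^sup>2" using pos by simp
    then have "(1 - ?c\<^sup>2 - ?d\<^sup>2) * (x 1)\<^sup>2 = 0" "(x 0 - ?c * x 1)\<^sup>2 = 0" "(x 2 - ?d * x 1)\<^sup>2 = 0"
      using x(3) zero_le_power2[of "x 0 - ?c * x 1"] zero_le_power2[of "x 2 - ?d * x 1"]
      unfolding form by linarith+
    then have "x 1 = 0" "x 0 = 0" "x 2 = 0" using pos by auto
    moreover have "i = 0 \<or> i = 1 \<or> i = 2" using x(1) by linarith
    ultimately show False using x(2) by auto
  qed
  then show ?thesis by simp
qed

lemma cos_mark_numeral: "cos_mark (numeral q) = cos (pi / numeral q)"
  by (simp add: numeral_eq_enat)

lemma cos_mark_nonneg: "k \<in> {2, 3, 4, 6, \<infinity>} \<Longrightarrow> 0 \<le> cos_mark k"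
  by (auto simp: cos_mark_numeral cos_30 cos_45 cos_60)

text \<open>
  The products of opposite Cartan integers are \<open>4 cos\<^sup>2(\<pi>/k)\<close> and \<open>4 cos\<^sup>2(\<pi>/l)\<close>; in a Euclidean diagram
  they add up to 4. The sign of \<open>a\<close> rules out \<open>a = a' = 1\<close> when the first product is 1.
\<close>

lemma affine_marks:
  fixes a a' d d' :: int
  assumes euc: "(cos_mark k)\<^sup>2 + (cos_mark l)\<^sup>2 = 1" and l: "l = 4 \<or> l = 6"
    and a: "real_of_int (a * a') = 4 * (cos_mark k)\<^sup>2" and d: "real_of_int (d * d') = 4 * (cos_mark l)\<^sup>2"
    and neg: "a \<le> 0"
  shows "a * a' = 2 \<and> d * d' = 2 \<or> a = -1 \<and> a' = -1 \<and> d * d' = 3"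
  using l
proof
  assume "l = 4"
  then have "(cos_mark l)\<^sup>2 = 1 / 2"
    by (simp add: cos_mark_numeral cos_45 power_divide)
  with euc a d have "real_of_int (a * a') = 2" "real_of_int (d * d') = 2"
    by linarith+
  then show ?thesis by linarith
next
  assume "l = 6"
  then have "(cos_mark l)\<^sup>2 = 3 / 4"
    by (simp add: cos_mark_numeral cos_30 power_divide)
  with euc a d have "real_of_int (a * a') = 1" "real_of_int (d * d') = 3"
    by linarith+
  then have "a * a' = 1" "d * d' = 3" by linarith+
  with neg show ?thesis by (auto simp: zmult_eq_1_iff)
qed

lemma factor_of_3_is_unit:
  fixes d d' :: int
  assumes "d * d' = 3"
  shows "\<bar>d\<bar> = 1 \<or> \<bar>d'\<bar> = 1"
proof -
  have "3 dvd d \<or> 3 dvd d'"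
    using assms prime_dvd_mult_iff[of "3::int" d d'] by simp
  then consider c where "d = 3 * c" | c where "d' = 3 * c"
    by (auto simp: dvd_def)
  then show ?thesis
    using assms by cases (auto simp: zmult_eq_1_iff)
qed

lemma two_nonzero_mod_ring:
  assumes "3 \<le> CARD('p::prime_card)"
  shows "(2 :: 'p mod_ring) \<noteq> 0"
proof
  assume "(2 :: 'p mod_ring) = 0"
  then have "of_nat 2 = (0 :: 'p mod_ring)" by simp
  then have "CARD('p) dvd 2"
    by (metis of_nat_eq_0_iff_char_dvd semiring_char_mod_ring)
  then show False using assms dvd_imp_le[of "CARD('p)" 2] by simp
qed

theorem theorem3p4:
  fixes k l m :: enat
    and B :: "'v::real_vector \<Rightarrow> 'v \<Rightarrow> real"
    and b :: "nat \<Rightarrow> 'v"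
  assumes "{k, l, m} \<subseteq> {2, 3, 4, 6, \<infinity>}"
    and "basic_system [k, l, m] B b"
    and "euclidean_coxeter [k, l] \<or> euclidean_coxeter [l, m]"
    and "l = 4 \<or> l = 6"
    and "3 \<le> CARD('p::prime_card)"
  shows "C_group (reduced_group B b 4) (reduced_reflection B b 4 :: nat \<Rightarrow> 'p mod_ring mat) 4"
proof (rule reduced_group_C_group[OF assms(2)])
  let ?a = "cartan_entry B b"
  let ?c = "\<lambda>i j. of_int (?a i j) :: 'p mod_ring"
  note bs = assms(2)
  have two: "(2 :: 'p mod_ring) \<noteq> 0"
    using assms(5) by (rule two_nonzero_mod_ring)
  interpret string_reflections "reflection_map ?c 4"
    "- ?c 0 1" "- ?c 1 0" "- ?c 1 2" "- ?c 2 1" "- ?c 2 3" "- ?c 3 2"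
  proof
    have diag: "?a 0 0 = 2" "?a 1 1 = 2" "?a 2 2 = 2" "?a 3 3 = 2"
      by (simp_all add: cartan_entry_diag[OF bs])
    have far: "?a 0 2 = 0" "?a 0 3 = 0" "?a 1 3 = 0" "?a 2 0 = 0" "?a 3 0 = 0" "?a 3 1 = 0"
      using basic_system_cartan_far[OF bs, of 0 2] basic_system_cartan_far[OF bs, of 0 3]
        basic_system_cartan_far[OF bs, of 1 3] by simp_all
    have sum4: "(\<Sum>j<4. f j) = f 0 + f 1 + f 2 + f 3" for f :: "nat \<Rightarrow> 'p mod_ring"
      by (simp add: eval_nat_numeral)
    fix x
    note eval = reflection_map_def sum4 diag[simplified] far[simplified]
    show "reflection_map ?c 4 0 x = x(0 := - ?c 0 1 * x 1 - x 0)"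
      by (auto simp: eval fun_eq_iff algebra_simps)
    show "reflection_map ?c 4 1 x = x(1 := - ?c 1 0 * x 0 + - ?c 1 2 * x 2 - x 1)"
      by (auto simp: eval fun_eq_iff algebra_simps)
    show "reflection_map ?c 4 2 x = x(2 := - ?c 2 1 * x 1 + - ?c 2 3 * x 3 - x 2)"
      by (auto simp: eval fun_eq_iff algebra_simps)
    show "reflection_map ?c 4 3 x = x(3 := - ?c 3 2 * x 2 - x 3)"
      by (auto simp: eval fun_eq_iff algebra_simps)
  qed (rule two)
  have nonneg: "0 \<le> cos_mark k" "0 \<le> cos_mark l" "0 \<le> cos_mark m"
    using assms(1) by (auto intro!: cos_mark_nonneg)
  note prods = basic_system_cartan_product[OF bs, of 0] basic_system_cartan_product[OF bs, of 1]
    basic_system_cartan_product[OF bs, of 2]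
  have "?a 0 1 * ?a 1 0 = 2 \<and> ?a 1 2 * ?a 2 1 = 2 \<or> ?a 0 1 = -1 \<and> ?a 1 0 = -1 \<and> ?a 1 2 * ?a 2 1 = 3
    \<or> ?a 3 2 * ?a 2 3 = 2 \<and> ?a 2 1 * ?a 1 2 = 2 \<or> ?a 3 2 = -1 \<and> ?a 2 3 = -1 \<and> ?a 2 1 * ?a 1 2 = 3"
    using assms(3)
  proof
    assume "euclidean_coxeter [k, l]"
    from affine_marks[OF euclidean_coxeter_rank_3[OF this] assms(4), of "?a 0 1" "?a 1 0" "?a 1 2" "?a 2 1"]
    show ?thesis using prods nonneg by (auto simp: numeral_2_eq_2)
  next
    assume "euclidean_coxeter [l, m]"
    then have "(cos_mark m)\<^sup>2 + (cos_mark l)\<^sup>2 = 1"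
      using euclidean_coxeter_rank_3[of l m] by simp
    from affine_marks[OF this assms(4), of "?a 3 2" "?a 2 3" "?a 2 1" "?a 1 2"]
    show ?thesis using prods nonneg by (auto simp: numeral_2_eq_2 numeral_3_eq_3 mult.commute)
  qed
  then consider "?a 0 1 * ?a 1 0 = 2" "?a 1 2 * ?a 2 1 = 2" | "?a 0 1 = -1" "?a 1 0 = -1" "?a 1 2 * ?a 2 1 = 3"
    | "?a 3 2 * ?a 2 3 = 2" "?a 2 1 * ?a 1 2 = 2" | "?a 3 2 = -1" "?a 2 3 = -1" "?a 2 1 * ?a 1 2 = 3"
    by blast
  then have mod_p: "affine_entries (- ?c 0 1) (- ?c 1 0) (- ?c 1 2) (- ?c 2 1) \<or>
      affine_entries (- ?c 3 2) (- ?c 2 3) (- ?c 2 1) (- ?c 1 2)"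
  proof cases
    case 1
    then show ?thesis
      unfolding affine_entries_def by (metis minus_mult_minus of_int_mult of_int_numeral)
  next
    case 2
    then show ?thesis
      unfolding affine_entries_def using factor_of_3_is_unit[OF 2(3)]
      by (auto simp: abs_if simp flip: of_int_mult split: if_splits)
  next
    case 3
    then show ?thesis
      unfolding affine_entries_def by (metis minus_mult_minus of_int_mult of_int_numeral)
  next
    case 4
    then show ?thesis
      unfolding affine_entries_def using factor_of_3_is_unit[OF 4(3)]
      by (auto simp: abs_if simp flip: of_int_mult split: if_splits)
  qed
  show "intersection_property (reflection_map ?c 4) {..<4}"
    using mod_p by (rule intersection_property_if_affine_or_reversed)
qed simp

end
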